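(* Let $\lambda$ be a nonzero real number. Let $(U_j)_{j\ge1}$ be independent random variables uniformly distributed on $(0,1)$ and $(X_j)_{j\ge1}$ independent exponential random variables with parameter $1$ (density $e^{-x}$ for $x\ge 0$), the two sequences being mutually independent, and put $S_k=U_1X_1+\cdots+U_kX_k$. Then for all integers $n,k$ with $n\ge k\ge 1$, \[ {n \brack k}_{-\lambda}^{*} =\sum_{m=k}^n \lambda^{m-k} \binom{n}{m} S_1(m,k)\, E\left[ (S_k)_{n-m, \lambda}\right], \] where $E$ denotes expectation.
   Context: The (signed) Stirling numbers of the first kind $S_1(n,k)$ are defined by $\frac{1}{k!}\log^k(1+t)=\sum_{n=k}^\infty S_1(n,k)\frac{t^n}{n!}$ for $k\ge0$. The degenerate falling factorial is $(x)_{0,\lambda}=1$, $(x)_{n,\lambda}=x(x-\lambda)(x-2\lambda)\cdots(x-(n-1)\lambda)$ for $n\ge1$. For nonzero real $\mu$, the unsigned new type degenerate Stirling numbers of the first kind ${n\brack k}_{\mu}^{*}$ are defined by $\frac{1}{k!}\log^k\!\left(\frac{1}{1+\frac{1}{\mu}\log(1-\mu t)}\right)=\sum_{n=k}^\infty {n\brack k}_{\mu}^{*}\frac{t^n}{n!}$ ($k\ge0$); in particular ${n\brack k}_{-\lambda}^{*}$ is this with $\mu=-\lambda$, i.e. $\frac{1}{k!}\log^k\!\left(\frac{1}{1-\frac{1}{\lambda}\log(1+\lambda t)}\right)=\sum_{n=k}^\infty {n\brack k}_{-\lambda}^{*}\frac{t^n}{n!}$. *)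

theory Defs
  imports
    "HOL-Probability.Probability"
    "HOL-Computational_Algebra.Formal_Power_Series"
begin

text \<open>
  Generating functions are formal power series over the reals. The library's
  \<^term>\<open>fps_ln 1\<close> is the series of \<open>log (1 + t)\<close>, so for a series \<open>f\<close> with constant
  coefficient \<open>1\<close> the series \<open>log f\<close> is obtained by substituting \<open>f - 1\<close> for \<open>t\<close>.
\<close>

definition fps_log :: "real fps \<Rightarrow> real fps" where
  "fps_log f = fps_compose (fps_ln 1) (f - 1)"

definition stirling1 :: "nat \<Rightarrow> nat \<Rightarrow> real" where
  "stirling1 n k =
     fact n * fps_nth (fps_const (1 / fact k) * fps_log (1 + fps_X) ^ k) n"

definition new_degen_stirling1 :: "real \<Rightarrow> nat \<Rightarrow> nat \<Rightarrow> real" where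
  "new_degen_stirling1 \<mu> n k =
     fact n * fps_nth (fps_const (1 / fact k) *
       fps_log (1 / (1 + fps_const (1 / \<mu>) * fps_log (1 - fps_const \<mu> * fps_X))) ^ k) n"

definition degen_ffact :: "real \<Rightarrow> nat \<Rightarrow> real \<Rightarrow> real" where
  "degen_ffact x n lam = (\<Prod>i<n. x - real i * lam)"

lemma fps_log_nth_0 [simp]: "fps_nth (fps_log f) 0 = 0"
  by (simp add: fps_log_def)

lemma fps_log_one_plus_X: "fps_log (1 + fps_X) = fps_ln 1"
  by (simp add: fps_log_def)

lemma stirling1_gf:
  "fps_const (1 / fact k) * fps_log (1 + fps_X) ^ k = Abs_fps (\<lambda>n. stirling1 n k / fact n)"
  by (rule fps_ext) (simp add: stirling1_def)

lemma new_degen_stirling1_gf: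
  "fps_const (1 / fact k) *
     fps_log (1 / (1 + fps_const (1 / \<mu>) * fps_log (1 - fps_const \<mu> * fps_X))) ^ k =
   Abs_fps (\<lambda>n. new_degen_stirling1 \<mu> n k / fact n)"
  by (rule fps_ext) (simp add: new_degen_stirling1_def)

lemma stirling1_eq_0: "n < k \<Longrightarrow> stirling1 n k = 0"
  by (simp add: stirling1_def startsby_zero_power_prefix)

lemma new_degen_stirling1_eq_0: "n < k \<Longrightarrow> new_degen_stirling1 \<mu> n k = 0"
  by (simp add: new_degen_stirling1_def startsby_zero_power_prefix)

end

theory Submission
  imports Defs
begin

text \<open>
  Write \<open>L = log (1 + \<lambda> t) / \<lambda>\<close>. The degenerate falling factorials of \<open>x\<close> have the exponential
  generating function \<open>exp (x L)\<close>, so the expectations on the right-hand side have the generating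
  function \<open>A (L)\<^sup>k\<close>, where \<open>A z = E [exp (z U X)]\<close>, read as a formal power series in \<open>z\<close>. The
  moments \<open>E [(U X)\<^sup>n] = n! / (n + 1)\<close> give \<open>z A z = - log (1 - z)\<close>. Hence
  \<open>log (1 / (1 - L))\<^sup>k = L\<^sup>k A (L)\<^sup>k\<close>, and comparing coefficients proves the claim, since
  \<open>L\<^sup>k\<close> generates the Stirling numbers of the first kind.
\<close>

unbundle no vec_syntax
unbundle fps_syntax

text \<open>The moment generating function \<open>E [exp (z Y)]\<close> as a formal series in
  \<open>z\<close>, so that no convergence in \<open>z\<close> has to be discussed.\<close>

definition moment_fps :: "'a measure \<Rightarrow> ('a \<Rightarrow> real) \<Rightarrow> real fps" where
  "moment_fps M Y = Abs_fps (\<lambda>n. (\<integral>\<omega>. Y \<omega> ^ n \<partial>M) / fact n)"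

section \<open>Moments of sums of independent variables\<close>

context prob_space
begin

lemma indep_var_power_mult:
  fixes Y Z :: "'a \<Rightarrow> real"
  assumes ind: "indep_var borel Y borel Z"
    and Y: "integrable M (\<lambda>\<omega>. Y \<omega> ^ i)" and Z: "integrable M (\<lambda>\<omega>. Z \<omega> ^ j)"
  shows "integrable M (\<lambda>\<omega>. Y \<omega> ^ i * Z \<omega> ^ j)"
    and "expectation (\<lambda>\<omega>. Y \<omega> ^ i * Z \<omega> ^ j) =
           expectation (\<lambda>\<omega>. Y \<omega> ^ i) * expectation (\<lambda>\<omega>. Z \<omega> ^ j)"
proof -
  have ind': "indep_var borel (\<lambda>\<omega>. Y \<omega> ^ i) borel (\<lambda>\<omega>. Z \<omega> ^ j)"
    using indep_var_compose[OF ind, of "\<lambda>x. x ^ i" borel "\<lambda>x. x ^ j" borel]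
    by (simp add: comp_def)
  show "integrable M (\<lambda>\<omega>. Y \<omega> ^ i * Z \<omega> ^ j)"
    using indep_var_integrable[OF ind' Y Z] .
  show "expectation (\<lambda>\<omega>. Y \<omega> ^ i * Z \<omega> ^ j) =
           expectation (\<lambda>\<omega>. Y \<omega> ^ i) * expectation (\<lambda>\<omega>. Z \<omega> ^ j)"
    using indep_var_lebesgue_integral[OF ind' Y Z] .
qed

text \<open>By independence the binomial expansion turns moments of the sum into a binomial
  convolution, which becomes a Cauchy product after division by \<open>n!\<close>.\<close>

lemma moment_fps_add:
  fixes Y Z :: "'a \<Rightarrow> real"
  assumes ind: "indep_var borel Y borel Z"
    and Y: "\<And>i. integrable M (\<lambda>\<omega>. Y \<omega> ^ i)" and Z: "\<And>i. integrable M (\<lambda>\<omega>. Z \<omega> ^ i)"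
  shows "integrable M (\<lambda>\<omega>. (Y \<omega> + Z \<omega>) ^ n)"
    and "moment_fps M (\<lambda>\<omega>. Y \<omega> + Z \<omega>) = moment_fps M Y * moment_fps M Z"
proof -
  note int = indep_var_power_mult(1)[OF ind Y Z]
  show "integrable M (\<lambda>\<omega>. (Y \<omega> + Z \<omega>) ^ n)"
    unfolding binomial_ring by (simp add: mult.assoc int)
  show "moment_fps M (\<lambda>\<omega>. Y \<omega> + Z \<omega>) = moment_fps M Y * moment_fps M Z"
  proof (rule fps_ext)
    fix n
    have "expectation (\<lambda>\<omega>. (Y \<omega> + Z \<omega>) ^ n) =
        (\<Sum>i\<le>n. real (n choose i) *
          (expectation (\<lambda>\<omega>. Y \<omega> ^ i) * expectation (\<lambda>\<omega>. Z \<omega> ^ (n - i))))"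
      unfolding binomial_ring
      by (simp add: mult.assoc int indep_var_power_mult(2)[OF ind Y Z])
    then show "moment_fps M (\<lambda>\<omega>. Y \<omega> + Z \<omega>) $ n = (moment_fps M Y * moment_fps M Z) $ n"
      by (auto simp: moment_fps_def fps_mult_nth sum_divide_distrib atLeast0AtMost binomial_fact
          intro!: sum.cong)
  qed
qed

text \<open>Integrability is part of the conclusion because the induction step applies
  \<open>moment_fps_add\<close> to the partial sum, all of whose powers must be integrable.\<close>

lemma moment_fps_sum:
  fixes Y :: "'i \<Rightarrow> 'a \<Rightarrow> real"
  assumes "finite I" "indep_vars (\<lambda>_. borel) Y I"
    and "\<And>i n. i \<in> I \<Longrightarrow> integrable M (\<lambda>\<omega>. Y i \<omega> ^ n)"
  shows "(\<forall>n. integrable M (\<lambda>\<omega>. (\<Sum>i\<in>I. Y i \<omega>) ^ n)) \<and>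
         moment_fps M (\<lambda>\<omega>. \<Sum>i\<in>I. Y i \<omega>) = (\<Prod>i\<in>I. moment_fps M (Y i))"
  using assms
proof (induction I rule: finite_induct)
  case empty
  then show ?case
    by (auto simp: moment_fps_def fps_eq_iff power_0_left prob_space)
next
  case (insert i I)
  have ind: "indep_var borel (Y i) borel (\<lambda>\<omega>. \<Sum>i\<in>I. Y i \<omega>)"
    by (rule indep_vars_sum) (use insert in auto)
  have IH: "(\<forall>n. integrable M (\<lambda>\<omega>. (\<Sum>i\<in>I. Y i \<omega>) ^ n)) \<and>
         moment_fps M (\<lambda>\<omega>. \<Sum>i\<in>I. Y i \<omega>) = (\<Prod>i\<in>I. moment_fps M (Y i))"
    using insert.prems by (intro insert.IH) (auto intro: indep_vars_subset)
  show ?case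
    using moment_fps_add[OF ind] IH insert.prems insert.hyps by simp
qed

section \<open>Moments of a uniform times an exponential variable\<close>

lemma uniform_moment:
  assumes D: "distributed M lborel U (\<lambda>x. indicator {0<..<1} x / measure lborel {0<..<1::real})"
  shows "expectation (\<lambda>\<omega>. U \<omega> ^ n) = 1 / (real n + 1)"
    and "integrable M (\<lambda>\<omega>. U \<omega> ^ n)"
proof -
  have D': "distributed M lborel U (\<lambda>x. ennreal (indicator {0<..<1} x))"
    using D by (simp add: ennreal_indicator)
  have "expectation (\<lambda>\<omega>. U \<omega> ^ n) = (\<integral>x. indicator {0<..<1} x * x ^ n \<partial>lborel)"
    by (subst distributed_integral[OF D']) auto
  \<comment> \<open>The endpoints form a null set; the closed interval is the form that
    \<open>integral_power\<close> evaluates.\<close>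
  also have "\<dots> = (\<integral>x. x ^ n * indicator {0..1} x \<partial>lborel)"
  proof (rule integral_cong_AE)
    have "AE x in lborel. x \<noteq> (0::real)" "AE x in lborel. x \<noteq> (1::real)"
      by (rule AE_lborel_singleton)+
    then show "AE x in lborel. indicator {0<..<1} x * x ^ n = x ^ n * (indicator {0..1} x :: real)"
      by eventually_elim (auto simp: indicator_def)
  qed auto
  also have "\<dots> = 1 / (real n + 1)"
    by (subst integral_power) (auto simp: add.commute)
  finally show *: "expectation (\<lambda>\<omega>. U \<omega> ^ n) = 1 / (real n + 1)" .
  \<comment> \<open>The integral of a non-integrable function is 0 by convention, so a nonzero
    moment forces integrability.\<close>
  have "1 / (real n + 1) \<noteq> 0"
    by (simp add: add_nonneg_eq_0_iff)
  then show "integrable M (\<lambda>\<omega>. U \<omega> ^ n)"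
    using * not_integrable_integral_eq by metis
qed

text \<open>The \<open>n\<close>-th exponential moment \<open>n!\<close> cancels the factorial in
  \<open>moment_fps\<close>, which leaves the uniform moment.\<close>

lemma moment_fps_uniform_mult_exponential:
  assumes U: "distributed M lborel U (\<lambda>x. indicator {0<..<1} x / measure lborel {0<..<1::real})"
    and X: "distributed M lborel X (exponential_density 1)"
    and ind: "indep_var borel U borel X"
  shows "integrable M (\<lambda>\<omega>. (U \<omega> * X \<omega>) ^ n)"
    and "moment_fps M (\<lambda>\<omega>. U \<omega> * X \<omega>) = Abs_fps (\<lambda>n. 1 / (real n + 1))"
proof -
  \<comment> \<open>The exponential density is the Erlang density of shape 0.\<close>
  note intX = erlang_ith_moment_integrable[OF zero_less_one X]
  note intU = uniform_moment(2)[OF U]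
  show "integrable M (\<lambda>\<omega>. (U \<omega> * X \<omega>) ^ n)"
    using indep_var_power_mult(1)[OF ind intU intX] by (simp add: power_mult_distrib)
  show "moment_fps M (\<lambda>\<omega>. U \<omega> * X \<omega>) = Abs_fps (\<lambda>n. 1 / (real n + 1))"
    using erlang_ith_moment[OF zero_less_one X]
    by (simp add: moment_fps_def power_mult_distrib indep_var_power_mult(2)[OF ind intU intX]
        uniform_moment(1)[OF U])
qed

text \<open>Functions of disjoint blocks of an independent family are independent: the blocks are
  \<open>{Inl j, Inr j}\<close> for the products, and the two singletons for a single pair.\<close>

lemma indep_vars_mult_pairs:
  fixes U X :: "'i \<Rightarrow> 'a \<Rightarrow> real"
  assumes ind: "indep_vars (\<lambda>_. borel) (case_sum U X) (I <+> I)"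
  shows "indep_vars (\<lambda>_. borel) (\<lambda>j \<omega>. U j \<omega> * X j \<omega>) I"
    and "j \<in> I \<Longrightarrow> indep_var borel (U j) borel (X j)"
proof -
  have "indep_vars (\<lambda>j. PiM {Inl j, Inr j} (\<lambda>_. borel))
      (\<lambda>j \<omega>. restrict (\<lambda>i. case_sum U X i \<omega>) {Inl j, Inr j}) I"
    by (rule indep_vars_restrict[OF ind]) (auto simp: disjoint_family_on_def)
  from indep_vars_compose2[OF this, of "\<lambda>j f. f (Inl j) * f (Inr j)" "\<lambda>_. borel"]
  show "indep_vars (\<lambda>_. borel) (\<lambda>j \<omega>. U j \<omega> * X j \<omega>) I"
    by simp
  assume j: "j \<in> I"
  have "indep_var (PiM {Inl j} (\<lambda>_. borel)) (\<lambda>\<omega>. restrict (\<lambda>i. case_sum U X i \<omega>) {Inl j})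
      (PiM {Inr j} (\<lambda>_. borel)) (\<lambda>\<omega>. restrict (\<lambda>i. case_sum U X i \<omega>) {Inr j})"
    by (rule indep_var_restrict[OF ind]) (use j in auto)
  from indep_var_compose[OF this, of "\<lambda>f. f (Inl j)" borel "\<lambda>f. f (Inr j)" borel]
  show "indep_var borel (U j) borel (X j)"
    by (simp add: comp_def)
qed

end

section \<open>Formal logarithms\<close>

lemma fps_deriv_log:
  assumes "f $ 0 = 1"
  shows "fps_deriv (fps_log f) = fps_deriv f / f"
proof -
  have "inverse (1 + fps_X) oo (f - 1) = inverse ((1 + fps_X) oo (f - 1))"
    by (rule fps_inverse_compose) (use assms in auto)
  also have "(1 + fps_X) oo (f - 1) = f"
    using assms by (simp add: fps_compose_add_distrib fps_X_fps_compose_startby0)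
  finally show ?thesis
    using assms
    by (simp add: fps_log_def fps_compose_deriv fps_ln_deriv fps_divide_unit mult.commute)
qed

text \<open>\<open>fps_X * ?A\<close> is the series of \<open>- log (1 - z)\<close>, with the
  geometric series as derivative. Both sides thus have derivative \<open>L' / (1 - L)\<close> and
  constant term 0.\<close>

lemma fps_log_geometric:
  fixes L :: "real fps"
  assumes L: "L $ 0 = 0"
  shows "fps_log (1 / (1 - L)) = L * (Abs_fps (\<lambda>n. 1 / (real n + 1)) oo L)"
proof -
  let ?A = "Abs_fps (\<lambda>n. 1 / (real n + 1))"
  let ?D = "1 - L"
  have D: "?D $ 0 = 1"
    using L by simp
  have XA: "fps_deriv (fps_X * ?A) = Abs_fps (\<lambda>n. 1)"
  proof (rule fps_ext)
    fix n
    have "1 + real n \<noteq> 0"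
      by linarith
    then show "fps_deriv (fps_X * ?A) $ n = Abs_fps (\<lambda>n. 1) $ n"
      by (simp add: add.commute flip: add_divide_distrib)
  qed
  have "fps_deriv (fps_log (1 / ?D)) = fps_deriv L * inverse ?D"
    using D by (subst fps_deriv_log)
      (auto simp: fps_divide_unit fps_inverse_deriv power2_eq_square inverse_mult_eq_1 mult.assoc)
  also have "\<dots> = fps_deriv ((fps_X * ?A) oo L)"
    unfolding fps_compose_deriv[OF L] XA gp[OF L]
    using D by (simp add: fps_divide_unit mult.commute)
  finally have "fps_log (1 / ?D) = (fps_X * ?A) oo L"
    by (simp add: fps_deriv_eq_iff)
  then show ?thesis
    using L by (simp add: fps_compose_mult_distrib fps_X_fps_compose_startby0)
qed

section \<open>Degenerate falling factorials\<close>

definition degen_log :: "real \<Rightarrow> real fps" where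
  "degen_log lam = fps_const (1 / lam) * fps_log (1 + fps_const lam * fps_X)"

lemma degen_log_nth_0 [simp]: "degen_log lam $ 0 = 0"
  by (simp add: degen_log_def)

text \<open>Substituting \<open>lam * t\<close> for \<open>t\<close> scales coefficient
  \<open>m\<close> by \<open>lam ^ m\<close>; the prefactor of the logarithm contributes
  \<open>1 / lam ^ k\<close>.\<close>

lemma degen_log_power_nth:
  "(degen_log lam ^ k) $ m = lam ^ m / lam ^ k * (fact k * stirling1 m k / fact m)"
proof -
  have "degen_log lam ^ k = fps_const ((1 / lam) ^ k) * (fps_ln 1 ^ k oo (fps_const lam * fps_X))"
    by (simp add: degen_log_def fps_log_def power_mult_distrib fps_const_power fps_compose_power)
  then show ?thesis
    by (simp add: stirling1_def fps_log_one_plus_X power_one_over)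
qed

text \<open>The series \<open>F = exp (x L)\<close> solves \<open>(1 + lam t) F' = x F\<close>,
  since \<open>L' = 1 / (1 + lam t)\<close>. Comparing coefficients gives the recursion obeyed by
  \<open>degen_ffact x n lam / fact n\<close>.\<close>

lemma degen_ffact_gf:
  assumes lam: "lam \<noteq> 0"
  shows "degen_ffact x n lam / fact n = (fps_exp x oo degen_log lam) $ n"
proof -
  define F where "F = fps_exp x oo degen_log lam"
  let ?f = "1 + fps_const lam * fps_X"
  have "fps_deriv (degen_log lam) = inverse ?f"
    using lam by (simp add: degen_log_def fps_deriv_log fps_divide_unit mult.assoc[symmetric])
  then have "fps_deriv F = fps_const x * F * inverse ?f"
    by (simp add: F_def fps_compose_deriv fps_compose_mult_distrib)
  then have "fps_deriv F * ?f = fps_const x * F * (inverse ?f * ?f)"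
    by (simp only: mult.assoc)
  then have ode: "fps_deriv F * ?f = fps_const x * F"
    by (simp add: inverse_mult_eq_1)
  have rec: "F $ Suc n = (x - real n * lam) * F $ n / (real n + 1)" for n
  proof -
    have "fps_deriv F * ?f = fps_deriv F + fps_const lam * (fps_X * fps_deriv F)"
      by (simp add: algebra_simps)
    also have "\<dots> $ n = (real n + 1) * F $ Suc n + lam * (real n * F $ n)"
      by (cases n) simp_all
    finally have "(fps_deriv F * ?f) $ n = (real n + 1) * F $ Suc n + lam * (real n * F $ n)" .
    with ode show ?thesis
      by (simp add: field_simps)
  qed
  have "degen_ffact x n lam / fact n = F $ n"
  proof (induction n)
    case 0
    then show ?case by (simp add: degen_ffact_def F_def)
  next
    case (Suc n)
    have "degen_ffact x (Suc n) lam / fact (Suc n) =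
        (degen_ffact x n lam / fact n) * (x - real n * lam) / (real n + 1)"
      by (simp add: degen_ffact_def add.commute)
    then show ?case by (simp only: Suc.IH rec mult.commute)
  qed
  then show ?thesis by (simp add: F_def)
qed

lemma (in prob_space) expectation_degen_ffact:
  assumes lam: "lam \<noteq> 0" and S: "\<And>j. integrable M (\<lambda>\<omega>. S \<omega> ^ j)"
  shows "expectation (\<lambda>\<omega>. degen_ffact (S \<omega>) n lam) = fact n * (moment_fps M S oo degen_log lam) $ n"
proof -
  \<comment> \<open>This is a polynomial in \<open>x\<close> with coefficients free of
    \<open>x\<close>, so the expectation can be taken term by term.\<close>
  have "degen_ffact x n lam = fact n * (\<Sum>j=0..n. x ^ j * ((degen_log lam ^ j) $ n / fact j))" for x
    using degen_ffact_gf[OF lam, of x n] by (simp add: fps_compose_nth field_simps)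
  then show ?thesis
    by (simp add: S fps_compose_nth moment_fps_def)
qed

theorem theorem2p2:
  fixes M :: "'a measure" and U X :: "nat \<Rightarrow> 'a \<Rightarrow> real"
    and lam :: real and n k :: nat
  assumes "prob_space M"
    and "lam \<noteq> 0"
    and "\<And>j. j \<ge> 1 \<Longrightarrow>
      distributed M lborel (U j) (\<lambda>x. indicator {0<..<1} x / measure lborel {0<..<1::real})"
    and "\<And>j. j \<ge> 1 \<Longrightarrow> distributed M lborel (X j) (exponential_density 1)"
    and "prob_space.indep_vars M (\<lambda>_. borel) (case_sum U X) ({1..} <+> {1..})"
    and "k \<ge> 1" and "n \<ge> k"
  shows "new_degen_stirling1 (- lam) n k =
    (\<Sum>m=k..n. lam ^ (m - k) * real (n choose m) * stirling1 m k *
       prob_space.expectation M (\<lambda>\<omega>. degen_ffact (\<Sum>j=1..k. U j \<omega> * X j \<omega>) (n - m) lam))"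
proof -
  interpret prob_space M by fact
  let ?A = "Abs_fps (\<lambda>n. 1 / (real n + 1))"
  let ?L = "degen_log lam"
  define S where "S = (\<lambda>\<omega>. \<Sum>j=1..k. U j \<omega> * X j \<omega>)"
  have UX: "integrable M (\<lambda>\<omega>. (U j \<omega> * X j \<omega>) ^ i)"
    "moment_fps M (\<lambda>\<omega>. U j \<omega> * X j \<omega>) = ?A" if "j \<ge> 1" for i j
    using moment_fps_uniform_mult_exponential[OF assms(3,4)[OF that]]
      indep_vars_mult_pairs(2)[OF assms(5)] that by auto
  have "indep_vars (\<lambda>_. borel) (\<lambda>j \<omega>. U j \<omega> * X j \<omega>) {1..k}"
    by (rule indep_vars_subset[OF indep_vars_mult_pairs(1)[OF assms(5)]]) auto
  from moment_fps_sum[OF _ this] UX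
  have intS: "integrable M (\<lambda>\<omega>. S \<omega> ^ i)" and momS: "moment_fps M S = ?A ^ k" for i
    by (auto simp: S_def)
  have E: "(?A ^ k oo ?L) $ i = expectation (\<lambda>\<omega>. degen_ffact (S \<omega>) i lam) / fact i" for i
    by (simp add: expectation_degen_ffact[OF assms(2) intS] momS)
  \<comment> \<open>With \<open>- lam\<close> as parameter the inner logarithm is that of
    \<open>1 + lam t\<close>, and the factor \<open>1 / - lam\<close> turns it into
    \<open>- ?L\<close>.\<close>
  have "fps_log (1 / (1 + fps_const (1 / - lam) * fps_log (1 - fps_const (- lam) * fps_X))) ^ k
      = fps_log (1 / (1 - ?L)) ^ k"
    by (simp add: degen_log_def flip: fps_const_neg)
  also have "\<dots> = ?L ^ k * (?A ^ k oo ?L)"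
    by (simp add: fps_log_geometric power_mult_distrib fps_compose_power)
  finally have "new_degen_stirling1 (- lam) n k = fact n / fact k * (?L ^ k * (?A ^ k oo ?L)) $ n"
    by (simp add: new_degen_stirling1_def)
  also have "\<dots> = (\<Sum>m=0..n. fact n / fact k * ((?L ^ k) $ m * (?A ^ k oo ?L) $ (n - m)))"
    by (simp add: fps_mult_nth sum_distrib_left)
  \<comment> \<open>\<open>?L\<close> has no constant term, so the coefficients of
    \<open>?L ^ k\<close> below \<open>k\<close> vanish.\<close>
  also have "\<dots> = (\<Sum>m=k..n. fact n / fact k * ((?L ^ k) $ m * (?A ^ k oo ?L) $ (n - m)))"
    by (rule sum.mono_neutral_right) (auto simp: startsby_zero_power_prefix)
  also have "\<dots> = (\<Sum>m=k..n. lam ^ (m - k) * real (n choose m) * stirling1 m k *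
       expectation (\<lambda>\<omega>. degen_ffact (S \<omega>) (n - m) lam))"
    \<comment> \<open>\<open>fact k\<close> cancels, the remaining factorials form
      \<open>n choose m\<close>, and \<open>lam ^ m / lam ^ k\<close> is
      \<open>lam ^ (m - k)\<close> as \<open>k \<le> m\<close>.\<close>
    unfolding E degen_log_power_nth
    by (rule sum.cong) (auto simp: binomial_fact power_diff assms(2) mult_ac)
  finally show ?thesis by (simp add: S_def)
qed

end
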